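(* Let $\mathbf{A}=\langle A,\vee,1\rangle$ be a distributive nearlattice. Then the following are equivalent: (1) $\mathbf{A}$ is quasicomplemented; (2) for each $a\in A$ there exists $b\in A$ such that $\psi[a^{\top\top}]\cap \mathrm{X}_m(A)=\psi[b^{\top}]\cap\mathrm{X}_m(A)$.
   Context: A distributive nearlattice is a join-semilattice $\langle A,\vee,1\rangle$ with greatest element $1$ in which every principal filter $[a)=\{x\in A\colon a\le x\}$ is a bounded distributive lattice. An ideal of $A$ is a subset $I$ that is downward closed and closed under $\vee$. A prime ideal is a non-empty proper ideal $P$ such that $a\wedge b\in P$ implies $a\in P$ or $b\in P$ whenever $a\wedge b$ exists; $\mathrm{X}(A)$ denotes the set of prime ideals. A maximal ideal is a non-empty proper ideal $I$ such that for every ideal $J\supseteq I$, $J=I$ or $J=A$; $\mathrm{X}_m(A)$ denotes the set of maximal ideals. For $Y\subseteq A$, $\psi[Y]=\{P\in\mathrm{X}(A)\colon Y\cap P\neq\emptyset\}$. For $a\in A$, $a^{\top}=\{x\in A\colon x\vee a=1\}$ and $a^{\top\top}=\{y\in A\colon y\vee x=1\text{ for all }x\in a^{\top}\}$. $\mathbf{A}$ is quasicomplemented if for each $a\in A$ there exists $b\in A$ with $a^{\top\top}=b^{\top}$. *)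

theory Defs
  imports "HOL-Algebra.Lattice"
begin

text \<open>Semilattices are carrier-based ordered structures: \<open>x \<squnion>\<^bsub>L\<^esub> y\<close> is the join and
  \<open>\<top>\<^bsub>L\<^esub>\<close> the greatest element \<open>1\<close>.\<close>

locale bounded_distributive_lattice = bounded_lattice L for L (structure) +
  assumes meet_join_distrib:
    "\<lbrakk>x \<in> carrier L; y \<in> carrier L; z \<in> carrier L\<rbrakk>
      \<Longrightarrow> x \<sqinter> (y \<squnion> z) = (x \<sqinter> y) \<squnion> (x \<sqinter> z)"

definition principal_filter :: "('a, 'b) gorder_scheme \<Rightarrow> 'a \<Rightarrow> 'a set" where
  "principal_filter L a = {x \<in> carrier L. a \<sqsubseteq>\<^bsub>L\<^esub> x}"

locale distributive_nearlattice =
  upper_semilattice L + weak_partial_order_top L for L (structure) +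
  assumes principal_filter_lattice:
    "a \<in> carrier L \<Longrightarrow> bounded_distributive_lattice (L\<lparr>carrier := principal_filter L a\<rparr>)"

text \<open>The empty set counts as an ideal; prime and maximal ideals are required to be non-empty.\<close>

definition nl_ideal :: "('a, 'b) gorder_scheme \<Rightarrow> 'a set \<Rightarrow> bool" where
  "nl_ideal L I \<longleftrightarrow> I \<subseteq> carrier L
     \<and> (\<forall>x\<in>carrier L. \<forall>y\<in>I. x \<sqsubseteq>\<^bsub>L\<^esub> y \<longrightarrow> x \<in> I)
     \<and> (\<forall>x\<in>I. \<forall>y\<in>I. x \<squnion>\<^bsub>L\<^esub> y \<in> I)"

text \<open>Meets are partial in a nearlattice, so ``\<open>a \<and> b\<close> exists and lies in \<open>P\<close>'' is stated via
  \<^const>\<open>is_glb\<close>.\<close>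

definition prime_ideals :: "('a, 'b) gorder_scheme \<Rightarrow> 'a set set" where
  "prime_ideals L = {P. nl_ideal L P \<and> P \<noteq> {} \<and> P \<noteq> carrier L
     \<and> (\<forall>a\<in>carrier L. \<forall>b\<in>carrier L. \<forall>m.
          is_glb L m {a, b} \<and> m \<in> P \<longrightarrow> a \<in> P \<or> b \<in> P)}"

definition maximal_ideals :: "('a, 'b) gorder_scheme \<Rightarrow> 'a set set" where
  "maximal_ideals L = {I. nl_ideal L I \<and> I \<noteq> {} \<and> I \<noteq> carrier L
     \<and> (\<forall>J. nl_ideal L J \<and> I \<subseteq> J \<longrightarrow> J = I \<or> J = carrier L)}"

definition psi :: "('a, 'b) gorder_scheme \<Rightarrow> 'a set \<Rightarrow> 'a set set" where
  "psi L Y = {P \<in> prime_ideals L. Y \<inter> P \<noteq> {}}"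

definition top_annihilator :: "('a, 'b) gorder_scheme \<Rightarrow> 'a \<Rightarrow> 'a set" where
  "top_annihilator L a = {x \<in> carrier L. x \<squnion>\<^bsub>L\<^esub> a = \<top>\<^bsub>L\<^esub>}"

definition top_biannihilator :: "('a, 'b) gorder_scheme \<Rightarrow> 'a \<Rightarrow> 'a set" where
  "top_biannihilator L a =
     {y \<in> carrier L. \<forall>x\<in>top_annihilator L a. y \<squnion>\<^bsub>L\<^esub> x = \<top>\<^bsub>L\<^esub>}"

definition quasicomplemented :: "('a, 'b) gorder_scheme \<Rightarrow> bool" where
  "quasicomplemented L \<longleftrightarrow>
     (\<forall>a\<in>carrier L. \<exists>b\<in>carrier L. top_biannihilator L a = top_annihilator L b)"

end

theory Submission
  imports Defs
begin

text \<open>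
  By Zorn's lemma, \<open>x \<or> y = 1\<close> holds iff no maximal ideal contains both \<open>x\<close> and \<open>y\<close>.
  Distributivity of the principal filters makes maximal ideals prime, and maximality shows that a
  maximal ideal meets \<open>b\<^sup>\<top>\<close> iff it omits \<open>b\<close>. So (2) says that a maximal ideal meets
  \<open>a\<^sup>\<top>\<^sup>\<top>\<close> iff it omits \<open>b\<close>, and testing \<open>x \<or> b = 1\<close> and \<open>x \<or> y = 1\<close> for \<open>y \<in> a\<^sup>\<top>\<close> on maximal
  ideals gives \<open>a\<^sup>\<top>\<^sup>\<top> = b\<^sup>\<top>\<close>.
\<close>

lemma nl_ideal_Union_chain:
  assumes ideal: "\<And>I. I \<in> C \<Longrightarrow> nl_ideal L I"
    and chain: "\<And>I J. I \<in> C \<Longrightarrow> J \<in> C \<Longrightarrow> I \<subseteq> J \<or> J \<subseteq> I"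
  shows "nl_ideal L (\<Union>C)"
  unfolding nl_ideal_def
proof (intro conjI ballI impI)
  show "\<Union>C \<subseteq> carrier L"
    using ideal unfolding nl_ideal_def by blast
next
  fix x y
  assume "x \<in> carrier L" "y \<in> \<Union>C" "x \<sqsubseteq>\<^bsub>L\<^esub> y"
  then show "x \<in> \<Union>C"
    using ideal unfolding nl_ideal_def by blast
next
  fix x y
  assume "x \<in> \<Union>C" "y \<in> \<Union>C"
  then obtain I where "I \<in> C" "x \<in> I" "y \<in> I"
    using chain by blast
  then show "x \<squnion>\<^bsub>L\<^esub> y \<in> \<Union>C"
    using ideal unfolding nl_ideal_def by blast
qed

lemma nl_ideal_downD:
  "\<lbrakk>nl_ideal L I; y \<in> I; x \<in> carrier L; x \<sqsubseteq>\<^bsub>L\<^esub> y\<rbrakk> \<Longrightarrow> x \<in> I"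
  unfolding nl_ideal_def by blast

lemma nl_ideal_joinD:
  "\<lbrakk>nl_ideal L I; x \<in> I; y \<in> I\<rbrakk> \<Longrightarrow> x \<squnion>\<^bsub>L\<^esub> y \<in> I"
  unfolding nl_ideal_def by blast

lemma nl_ideal_closedD: "\<lbrakk>nl_ideal L I; x \<in> I\<rbrakk> \<Longrightarrow> x \<in> carrier L"
  unfolding nl_ideal_def by blast

lemma maximal_ideals_nl_ideal: "M \<in> maximal_ideals L \<Longrightarrow> nl_ideal L M"
  unfolding maximal_ideals_def by blast

context distributive_nearlattice
begin

lemma nl_ideal_eq_carrier_iff:
  assumes "nl_ideal L I"
  shows "I = carrier L \<longleftrightarrow> \<top> \<in> I"
  using assms nl_ideal_downD [OF assms] nl_ideal_closedD [OF assms] by auto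

lemma nl_ideal_principal:
  assumes "c \<in> carrier L"
  shows "nl_ideal L {x \<in> carrier L. x \<sqsubseteq> c}"
  using assms unfolding nl_ideal_def by (auto intro: le_trans join_le)

text \<open>For nonempty \<open>I\<close> this is the ideal generated by \<open>I\<close> and
  \<open>a\<close>, the one against which maximality is tested. Bounds \<open>i \<squnion> a\<close>
  and \<open>j \<squnion> a\<close> are merged into
  \<open>(i \<squnion> j) \<squnion> a\<close>.\<close>

lemma nl_ideal_adjoin:
  assumes I: "nl_ideal L I" and a: "a \<in> carrier L"
  shows "nl_ideal L {x \<in> carrier L. \<exists>i\<in>I. x \<sqsubseteq> i \<squnion> a}"
  unfolding nl_ideal_def
proof (intro conjI ballI impI)
  fix x y
  assume "x \<in> carrier L" "y \<in> {x \<in> carrier L. \<exists>i\<in>I. x \<sqsubseteq> i \<squnion> a}" "x \<sqsubseteq> y"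
  then show "x \<in> {x \<in> carrier L. \<exists>i\<in>I. x \<sqsubseteq> i \<squnion> a}"
    using a nl_ideal_closedD [OF I] by (blast intro: le_trans join_closed)
next
  fix x y
  assume "x \<in> {x \<in> carrier L. \<exists>i\<in>I. x \<sqsubseteq> i \<squnion> a}" "y \<in> {x \<in> carrier L. \<exists>i\<in>I. x \<sqsubseteq> i \<squnion> a}"
  then obtain i j where x: "x \<in> carrier L" "i \<in> I" "x \<sqsubseteq> i \<squnion> a"
    and y: "y \<in> carrier L" "j \<in> I" "y \<sqsubseteq> j \<squnion> a"
    by blast
  have ij: "i \<in> carrier L" "j \<in> carrier L"
    using x y nl_ideal_closedD [OF I] by auto
  have "i \<sqsubseteq> (i \<squnion> j) \<squnion> a" "j \<sqsubseteq> (i \<squnion> j) \<squnion> a" "a \<sqsubseteq> (i \<squnion> j) \<squnion> a"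
    using ij a by (meson join_left join_right join_closed le_trans)+
  then have "i \<squnion> a \<sqsubseteq> (i \<squnion> j) \<squnion> a" "j \<squnion> a \<sqsubseteq> (i \<squnion> j) \<squnion> a"
    using ij a by (simp_all add: join_le)
  then have "x \<sqsubseteq> (i \<squnion> j) \<squnion> a" "y \<sqsubseteq> (i \<squnion> j) \<squnion> a"
    using x y ij a by (meson join_closed le_trans)+
  then have "x \<squnion> y \<sqsubseteq> (i \<squnion> j) \<squnion> a"
    using x y ij a by (simp add: join_le)
  then show "x \<squnion> y \<in> {x \<in> carrier L. \<exists>i\<in>I. x \<sqsubseteq> i \<squnion> a}"
    using x y nl_ideal_joinD [OF I] by auto
qed auto

text \<open>Zorn's lemma is applied to the ideals that contain \<open>I\<close> and omit
  \<open>\<top>\<close>. For an ideal, omitting \<open>\<top>\<close> is the same as being proper,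
  and this form visibly survives unions of chains.\<close>

lemma exists_maximal_ideal:
  assumes I: "nl_ideal L I" "I \<noteq> {}" "\<top> \<notin> I"
  obtains M where "M \<in> maximal_ideals L" "I \<subseteq> M"
proof -
  let ?P = "{J. nl_ideal L J \<and> I \<subseteq> J \<and> \<top> \<notin> J}"
  have "\<exists>M\<in>?P. \<forall>X\<in>?P. M \<subseteq> X \<longrightarrow> X = M"
  proof (rule subset_Zorn_nonempty)
    show "?P \<noteq> {}"
      using I by blast
  next
    fix C
    assume "C \<noteq> {}" and C: "subset.chain ?P C"
    then have P: "C \<subseteq> ?P" and lin: "\<And>I J. I \<in> C \<Longrightarrow> J \<in> C \<Longrightarrow> I \<subseteq> J \<or> J \<subseteq> I"
      by (auto simp: subset_chain_def)
    have "nl_ideal L (\<Union>C)"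
      using P lin by (intro nl_ideal_Union_chain) auto
    \<comment> \<open>Nonemptiness of \<open>C\<close> is what gives
      \<open>I \<subseteq> \<Union>C\<close>.\<close>
    then show "\<Union>C \<in> ?P"
      using P \<open>C \<noteq> {}\<close> by blast
  qed
  then obtain M where "M \<in> ?P" and "\<forall>X\<in>?P. M \<subseteq> X \<longrightarrow> X = M"
    by (rule bexE)
  then have M: "nl_ideal L M" "I \<subseteq> M" "\<top> \<notin> M"
    and max: "\<And>X. \<lbrakk>nl_ideal L X; I \<subseteq> X; \<top> \<notin> X; M \<subseteq> X\<rbrakk> \<Longrightarrow> X = M"
    by simp_all
  have "J = M \<or> J = carrier L" if "nl_ideal L J" "M \<subseteq> J" for J
    using that M max [of J] nl_ideal_eq_carrier_iff by blast
  then have "M \<in> maximal_ideals L"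
    using M I nl_ideal_eq_carrier_iff [OF M(1)] unfolding maximal_ideals_def by blast
  then show thesis
    using M that by blast
qed

lemma top_notin_maximal_ideal: "M \<in> maximal_ideals L \<Longrightarrow> \<top> \<notin> M"
  using nl_ideal_eq_carrier_iff unfolding maximal_ideals_def by blast

text \<open>If \<open>x \<squnion> y\<close> is not \<open>\<top>\<close>, the principal ideal below
  it is proper and extends to a maximal ideal, which contains both \<open>x\<close> and
  \<open>y\<close>. Conversely, a maximal ideal containing both would contain their join.\<close>

lemma join_eq_top_iff:
  assumes x: "x \<in> carrier L" and y: "y \<in> carrier L"
  shows "x \<squnion> y = \<top> \<longleftrightarrow> (\<forall>M\<in>maximal_ideals L. \<not> (x \<in> M \<and> y \<in> M))"
proof (intro iffI ballI notI)
  fix M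
  assume "x \<squnion> y = \<top>" "M \<in> maximal_ideals L" "x \<in> M \<and> y \<in> M"
  then show False
    using nl_ideal_joinD [OF maximal_ideals_nl_ideal, of M L x y] top_notin_maximal_ideal
    by simp
next
  assume none: "\<forall>M\<in>maximal_ideals L. \<not> (x \<in> M \<and> y \<in> M)"
  let ?I = "{z \<in> carrier L. z \<sqsubseteq> x \<squnion> y}"
  have xy: "x \<in> ?I" "y \<in> ?I"
    using x y by (simp_all add: join_left join_right)
  have "\<top> \<in> ?I"
  proof (rule ccontr)
    assume "\<top> \<notin> ?I"
    moreover have "nl_ideal L ?I"
      using x y by (simp add: nl_ideal_principal)
    moreover have "?I \<noteq> {}"
      using xy by blast
    ultimately obtain M where "M \<in> maximal_ideals L" "?I \<subseteq> M"
      using exists_maximal_ideal by metis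
    then show False
      using none xy by blast
  qed
  then show "x \<squnion> y = \<top>"
    using x y by (auto intro: le_antisym)
qed

text \<open>If \<open>M\<close> omits \<open>a\<close>, then \<open>M\<close> and \<open>a\<close>
  together generate all of \<open>carrier L\<close>, so \<open>\<top>\<close> lies below some
  \<open>i \<squnion> a\<close> with \<open>i\<close> in \<open>M\<close>. This \<open>i\<close> is
  the common element.\<close>

lemma maximal_ideal_meets_top_annihilator_iff:
  assumes M: "M \<in> maximal_ideals L" and a: "a \<in> carrier L"
  shows "top_annihilator L a \<inter> M \<noteq> {} \<longleftrightarrow> a \<notin> M"
proof
  assume "top_annihilator L a \<inter> M \<noteq> {}"
  then show "a \<notin> M"
    using join_eq_top_iff [OF _ a] M unfolding top_annihilator_def by blast
next
  assume aM: "a \<notin> M"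
  have I: "nl_ideal L M" and ne: "M \<noteq> {}"
    and max: "\<And>J. \<lbrakk>nl_ideal L J; M \<subseteq> J\<rbrakk> \<Longrightarrow> J = M \<or> J = carrier L"
    using M unfolding maximal_ideals_def by auto
  let ?J = "{x \<in> carrier L. \<exists>i\<in>M. x \<sqsubseteq> i \<squnion> a}"
  have "M \<subseteq> ?J" "a \<in> ?J"
    using a ne nl_ideal_closedD [OF I] by (blast intro: join_left join_right)+
  then have "?J = carrier L"
    using max [OF nl_ideal_adjoin [OF I a]] aM by blast
  then obtain i where "i \<in> M" "\<top> \<sqsubseteq> i \<squnion> a"
    using top_closed by blast
  moreover from this have "i \<in> carrier L"
    using nl_ideal_closedD [OF I] by blast
  ultimately have "i \<squnion> a = \<top>" "i \<in> carrier L" "i \<in> M"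
    using a by (auto intro: le_antisym)
  then show "top_annihilator L a \<inter> M \<noteq> {}"
    unfolding top_annihilator_def by blast
qed

text \<open>This is where distributivity enters. All elements involved lie in the filter above
  \<open>m\<close>, and there b = b \<and> (a \<or> k) = (b \<and> a) \<or> (b \<and> k) \<le> m
  \<or> k = k.\<close>

lemma glb_below_of_join_eq_top:
  assumes carr: "a \<in> carrier L" "b \<in> carrier L" "k \<in> carrier L"
    and m: "is_glb L m {a, b}" and mk: "m \<sqsubseteq> k" and ak: "a \<squnion> k = \<top>"
  shows "b \<sqsubseteq> k"
proof -
  have mc: "m \<in> carrier L" and ma: "m \<sqsubseteq> a" and mb: "m \<sqsubseteq> b"
    and glb: "\<And>z. \<lbrakk>z \<in> carrier L; z \<sqsubseteq> a; z \<sqsubseteq> b\<rbrakk> \<Longrightarrow> z \<sqsubseteq> m"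
    using m carr unfolding greatest_def Lower_def by auto
  \<comment> \<open>\<open>F\<close> inherits the order of \<open>L\<close>, but its joins and meets
    are formed in the smaller carrier, so they are compared with those of \<open>L\<close> through
    their order properties only.\<close>
  define F where "F = L\<lparr>carrier := principal_filter L m\<rparr>"
  have le: "(\<sqsubseteq>\<^bsub>F\<^esub>) = (\<sqsubseteq>)"
    by (simp add: F_def)
  have cF: "x \<in> carrier F \<longleftrightarrow> x \<in> carrier L \<and> m \<sqsubseteq> x" for x
    by (simp add: F_def principal_filter_def)
  interpret F: bounded_distributive_lattice F
    unfolding F_def using mc by (rule principal_filter_lattice)
  have F: "a \<in> carrier F" "b \<in> carrier F" "k \<in> carrier F" "m \<in> carrier F"
    using carr mc ma mb mk by (simp_all add: cF)
  \<comment> \<open>The join in \<open>F\<close> is an upper bound of \<open>a\<close> and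
    \<open>k\<close> in \<open>L\<close> too, hence lies above
    \<open>a \<squnion> k\<close>.\<close>
  have "\<top> \<sqsubseteq> a \<squnion>\<^bsub>F\<^esub> k"
    using F F.join_left [of a k] F.join_right [of a k] F.join_closed [of a k] carr
    by (subst ak [symmetric], intro join_le) (auto simp: le cF)
  then have "b \<sqsubseteq>\<^bsub>F\<^esub> a \<squnion>\<^bsub>F\<^esub> k"
    using F F.join_closed [of a k] carr by (auto simp: le cF intro: le_trans)
  then have "b \<sqsubseteq>\<^bsub>F\<^esub> b \<sqinter>\<^bsub>F\<^esub> (a \<squnion>\<^bsub>F\<^esub> k)"
    using F by (intro F.meet_le) auto
  also have "b \<sqinter>\<^bsub>F\<^esub> (a \<squnion>\<^bsub>F\<^esub> k) = (b \<sqinter>\<^bsub>F\<^esub> a) \<squnion>\<^bsub>F\<^esub> (b \<sqinter>\<^bsub>F\<^esub> k)"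
    using F by (intro F.meet_join_distrib)
  finally have b: "b \<sqsubseteq>\<^bsub>F\<^esub> (b \<sqinter>\<^bsub>F\<^esub> a) \<squnion>\<^bsub>F\<^esub> (b \<sqinter>\<^bsub>F\<^esub> k)" .
  have "b \<sqinter>\<^bsub>F\<^esub> a \<sqsubseteq> m"
    using F F.meet_left [of b a] F.meet_right [of b a] F.meet_closed [of b a]
    by (intro glb) (auto simp: le cF)
  then have "b \<sqinter>\<^bsub>F\<^esub> a \<sqsubseteq>\<^bsub>F\<^esub> k"
    using F mk F.le_trans [of "b \<sqinter>\<^bsub>F\<^esub> a" m k] by (simp add: le)
  then have "(b \<sqinter>\<^bsub>F\<^esub> a) \<squnion>\<^bsub>F\<^esub> (b \<sqinter>\<^bsub>F\<^esub> k) \<sqsubseteq>\<^bsub>F\<^esub> k"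
    using F by (intro F.join_le F.meet_right) auto
  then have "b \<sqsubseteq>\<^bsub>F\<^esub> k"
    using b F by (meson F.le_trans F.join_closed F.meet_closed)
  then show ?thesis
    by (simp add: le)
qed

text \<open>Suppose the meet \<open>m\<close> of \<open>a\<close> and \<open>b\<close> lies in
  \<open>M\<close> while \<open>a\<close> does not. Some \<open>i\<close> in \<open>M\<close> has
  join \<open>\<top>\<close> with \<open>a\<close>; then \<open>i \<squnion> m\<close> is in
  \<open>M\<close>, lies above \<open>m\<close> and also joins with \<open>a\<close> to
  \<open>\<top>\<close>, so the preceding lemma puts \<open>b\<close> below it.\<close>

lemma maximal_ideals_subset_prime_ideals: "maximal_ideals L \<subseteq> prime_ideals L"
proof
  fix M
  assume M: "M \<in> maximal_ideals L"
  note I = maximal_ideals_nl_ideal [OF M]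
  have "b \<in> M"
    if carr: "a \<in> carrier L" "b \<in> carrier L" and m: "is_glb L m {a, b}" "m \<in> M"
      and a: "a \<notin> M" for a b m
  proof -
    obtain i where i: "i \<in> M" "i \<squnion> a = \<top>"
      using maximal_ideal_meets_top_annihilator_iff [OF M carr(1)] a
      unfolding top_annihilator_def by blast
    have ic: "i \<in> carrier L" "m \<in> carrier L"
      using i m nl_ideal_closedD [OF I] by auto
    have kM: "i \<squnion> m \<in> M"
      using nl_ideal_joinD [OF I] i m by blast
    have "i \<sqsubseteq> a \<squnion> (i \<squnion> m)" "a \<sqsubseteq> a \<squnion> (i \<squnion> m)"
      using ic carr by (meson join_left join_right join_closed le_trans)+
    then have "\<top> \<sqsubseteq> a \<squnion> (i \<squnion> m)"
      using ic carr by (subst i(2) [symmetric], intro join_le) auto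
    then have "a \<squnion> (i \<squnion> m) = \<top>"
      using ic carr by (auto intro: le_antisym)
    then have "b \<sqsubseteq> i \<squnion> m"
      using glb_below_of_join_eq_top [OF carr _ m(1)] ic by (simp add: join_right)
    then show ?thesis
      using nl_ideal_downD [OF I kM] carr by blast
  qed
  then show "M \<in> prime_ideals L"
    using M unfolding prime_ideals_def maximal_ideals_def by blast
qed

text \<open>Since maximal ideals are prime, the primeness built into \<open>psi\<close> imposes no
  further condition on them.\<close>

lemma psi_Int_maximal_ideals:
  "psi L Y \<inter> maximal_ideals L = {M \<in> maximal_ideals L. Y \<inter> M \<noteq> {}}"
  using maximal_ideals_subset_prime_ideals unfolding psi_def by blast

lemma top_biannihilator_eq_if_psi_eq:
  assumes b: "b \<in> carrier L"
    and eq: "psi L (top_biannihilator L a) \<inter> maximal_ideals L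
      = psi L (top_annihilator L b) \<inter> maximal_ideals L"
  shows "top_biannihilator L a = top_annihilator L b"
proof -
  have meets: "top_biannihilator L a \<inter> M \<noteq> {} \<longleftrightarrow> b \<notin> M" if "M \<in> maximal_ideals L" for M
    using eq that maximal_ideal_meets_top_annihilator_iff [OF that b]
    unfolding psi_Int_maximal_ideals by blast
  show ?thesis
  proof (intro equalityI subsetI)
    fix x
    assume x: "x \<in> top_biannihilator L a"
    then have xc: "x \<in> carrier L"
      by (simp add: top_biannihilator_def)
    \<comment> \<open>A maximal ideal containing \<open>x\<close> meets the biannihilator in
      \<open>x\<close> itself, so it omits \<open>b\<close>.\<close>
    have "x \<squnion> b = \<top>"
      unfolding join_eq_top_iff [OF xc b] using meets x by blast
    then show "x \<in> top_annihilator L b"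
      using xc by (simp add: top_annihilator_def)
  next
    fix x
    assume "x \<in> top_annihilator L b"
    then have xc: "x \<in> carrier L" and xb: "x \<squnion> b = \<top>"
      by (simp_all add: top_annihilator_def)
    have "x \<squnion> y = \<top>" if y: "y \<in> top_annihilator L a" for y
    proof -
      have yc: "y \<in> carrier L"
        using y by (simp add: top_annihilator_def)
      \<comment> \<open>Containing \<open>x\<close>, the ideal \<open>M\<close> omits
        \<open>b\<close> and so contains some \<open>z\<close> of the biannihilator. But
        \<open>z\<close> joins with \<open>y\<close> to \<open>\<top>\<close>, and both lie in
        \<open>M\<close>.\<close>
      have False if M: "M \<in> maximal_ideals L" and xy: "x \<in> M" "y \<in> M" for M
      proof -
        have "b \<notin> M"
          using xb join_eq_top_iff [OF xc b] M xy by blast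
        then obtain z where z: "z \<in> top_biannihilator L a" "z \<in> M"
          using meets [OF M] by blast
        then have "z \<in> carrier L" "z \<squnion> y = \<top>"
          using y by (auto simp: top_biannihilator_def)
        then show False
          using join_eq_top_iff [OF _ yc] M xy z by blast
      qed
      then show ?thesis
        unfolding join_eq_top_iff [OF xc yc] by blast
    qed
    then show "x \<in> top_biannihilator L a"
      using xc by (simp add: top_biannihilator_def)
  qed
qed

end

theorem theorem3p5:
  fixes A :: "('a, 'b) gorder_scheme"
  assumes "distributive_nearlattice A"
  shows "quasicomplemented A \<longleftrightarrow>
    (\<forall>a\<in>carrier A. \<exists>b\<in>carrier A.
       psi A (top_biannihilator A a) \<inter> maximal_ideals A
         = psi A (top_annihilator A b) \<inter> maximal_ideals A)"
  \<comment> \<open>Both directions keep the same \<open>b\<close>; from left to right, equal sets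
    have equal images under \<open>psi\<close>.\<close>
  using distributive_nearlattice.top_biannihilator_eq_if_psi_eq [OF assms]
  unfolding quasicomplemented_def by metis

end
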